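(* Let $R$ be a commutative semiring, $M$ an $R$-semimodule, and let $\mathrm{Dis}_M$ be a subsemimodule space (for any one of the distinguished classes of subsemimodules of $M$). Then every non-empty irreducible subbasis closed set $\mathcal V(N)$ ($N\in\mathrm{Sub}_M$) of $\mathrm{Dis}_M$ has a unique generic point if and only if every non-empty irreducible subbasis closed set $\mathcal V(N)$ of $\mathrm{Dis}_M$ contains $N^{\omega}$, where $N^{\omega}=\bigcap\{L\mid L\in\mathcal V(N)\}$.
   Context: A (commutative) semiring is $(R,+,0,\cdot,1)$ with $(R,+,0)$ and $(R,\cdot,1)$ commutative monoids, $0r=0=r0$ for all $r$, and $\cdot$ distributing over $+$. An $R$-semimodule $M$ is an additive commutative monoid with a scalar multiplication $R\times M\to M$ satisfying $(r+r')m=rm+r'm$, $r(m+m')=rm+rm'$, $(rr')m=r(r'm)$, $1m=m$, $r0=0=0m$. A subsemimodule of $M$ is a nonempty subset closed under addition and scalar multiplication; $\mathrm{Sub}_M$ is the set of all of them. Write $(N:M)=\{r\in R\mid rM\subseteq N\}$. Distinguished classes. A subsemimodule $N$ of $M$ is: subtractive if $x+y\in N$ and $x\in N$ imply $y\in N$; strong if $x+y\in N$ implies $x,y\in N$; proper if $N\ne M$; maximal if $N$ is proper and no other proper subsemimodule contains $N$; prime if $N$ is proper and $rm\in N$ ($r\in R$, $m\in M$) implies $m\in N$ or $r\in (N:M)$; primary if $N$ is proper and $rm\in N$ implies $m\in N$ or $r^n\in (N:M)$ for some $n\in\mathbb N$; weakly prime if $N$ is proper and $0\ne rm\in N$ implies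 $m\in N$ or $rM\subseteq N$; primal if $N$ is proper and $R\setminus \mathrm{Prm}(N)$ is an ideal of $R$, where $\mathrm{Prm}(N)$ is the set of $r\in R$ such that, for all $m\in M$, $rm\in N$ implies $m\in N$; semiprime if $N$ is an intersection of prime subsemimodules of $M$; extraordinary if $N$ is prime and for all semiprime subsemimodules $L,K$, $L\cap K\subseteq N$ implies $L\subseteq N$ or $K\subseteq N$; strongly irreducible if for all subsemimodules $L,K$, $L\cap K\subseteq N$ implies $L\subseteq N$ or $K\subseteq N$; irreducible (completely irreducible) if $N$ is not the intersection of two (of any set of) subsemimodules of $M$ in which $N$ is properly contained; cyclic (finitely generated) if $N$ is generated by one element (by a finite set of elements); minimal if $N\neq 0$ and $N$ contains no other nonzero subsemimodule; minimal prime if $N$ is both minimal and prime. $\mathrm{Dis}_M$ denotes the set of all subsemimodules of $M$ of any one of these types, with the convention $M\notin \mathrm{Dis}_M$. For $N\in\mathrm{Sub}_M$ put $\mathcal V(N)=\{L\in\mathrm{Dis}_M\mid N\subseteq L\}$; these are the subbasis closed sets. The topology on $\mathrm{Dis}_M$ is the one having $\{\mathcal V(N)\}_{N\in \mathrm{Sub}_M}$ as a closed subbasis (closed sets are arbitrary intersections of finite unions of sets $\mathcal V(N)$); $\mathrm{Dis}_M$ with this topology is called a subsemimodule space. A closed subset $S$ of a topological space is irreducible if it is not the union of two properly smaller closed subsets $S_1,S_2\subsetneq S$. A point $x$ of a closed set $S$ is a generic point of $S$ if $S$ is the closure of $\{x\}$. *)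

theory Defs
  imports "HOL-Analysis.Abstract_Topology"
begin

(* The sort {comm_semiring_0, comm_monoid_mult} is that of commutative semirings with 0 and 1;
   unlike comm_semiring_1 it does not require 0 to differ from 1. *)
definition semiring_ideal :: "'r::{comm_semiring_0,comm_monoid_mult} set \<Rightarrow> bool" where
  "semiring_ideal I \<longleftrightarrow> I \<noteq> {} \<and> (\<forall>a\<in>I. \<forall>b\<in>I. a + b \<in> I) \<and> (\<forall>r. \<forall>a\<in>I. r * a \<in> I)"

datatype dis_class =
    Subtractive | Strong | Proper | Maximal | Prime | Primary | Weakly_Prime | Primal
  | Semiprime | Extraordinary | Strongly_Irreducible | Irreducible | Completely_Irreducible
  | Cyclic | Finitely_Generated | Minimal | Minimal_Prime

locale semimodule =
  fixes scale :: "'r::{comm_semiring_0,comm_monoid_mult} \<Rightarrow> 'm::comm_monoid_add \<Rightarrow> 'm"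
    (infixr \<open>*s\<close> 75)
  assumes scale_left_distrib: "(r + r') *s m = r *s m + r' *s m"
    and scale_right_distrib: "r *s (m + m') = r *s m + r *s m'"
    and scale_assoc: "(r * r') *s m = r *s (r' *s m)"
    and scale_one: "1 *s m = m"
    and scale_zero_right: "r *s 0 = 0"
    and scale_zero_left: "0 *s m = 0"
begin

(* The semimodule M is the whole type 'm, so M appears below as UNIV. *)

definition subsemimodule :: "'m set \<Rightarrow> bool" where
  "subsemimodule N \<longleftrightarrow>
    N \<noteq> {} \<and> (\<forall>x\<in>N. \<forall>y\<in>N. x + y \<in> N) \<and> (\<forall>r. \<forall>x\<in>N. r *s x \<in> N)"

(* (N : M) *)
definition residual :: "'m set \<Rightarrow> 'r set" where
  "residual N = {r. range (\<lambda>m. r *s m) \<subseteq> N}"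

definition proper :: "'m set \<Rightarrow> bool" where
  "proper N \<longleftrightarrow> subsemimodule N \<and> N \<noteq> UNIV"

definition subtractive :: "'m set \<Rightarrow> bool" where
  "subtractive N \<longleftrightarrow> subsemimodule N \<and> (\<forall>x y. x + y \<in> N \<and> x \<in> N \<longrightarrow> y \<in> N)"

definition strong :: "'m set \<Rightarrow> bool" where
  "strong N \<longleftrightarrow> subsemimodule N \<and> (\<forall>x y. x + y \<in> N \<longrightarrow> x \<in> N \<and> y \<in> N)"

definition maximal :: "'m set \<Rightarrow> bool" where
  "maximal N \<longleftrightarrow> proper N \<and> (\<forall>K. proper K \<and> N \<subseteq> K \<longrightarrow> K = N)"

definition prime :: "'m set \<Rightarrow> bool" where
  "prime N \<longleftrightarrow> proper N \<and> (\<forall>r m. r *s m \<in> N \<longrightarrow> m \<in> N \<or> r \<in> residual N)"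

definition primary :: "'m set \<Rightarrow> bool" where
  "primary N \<longleftrightarrow>
    proper N \<and> (\<forall>r m. r *s m \<in> N \<longrightarrow> m \<in> N \<or> (\<exists>n::nat. r ^ n \<in> residual N))"

definition weakly_prime :: "'m set \<Rightarrow> bool" where
  "weakly_prime N \<longleftrightarrow>
    proper N \<and> (\<forall>r m. r *s m \<noteq> 0 \<and> r *s m \<in> N \<longrightarrow> m \<in> N \<or> r \<in> residual N)"

definition Prm :: "'m set \<Rightarrow> 'r set" where
  "Prm N = {r. \<forall>m. r *s m \<in> N \<longrightarrow> m \<in> N}"

definition primal :: "'m set \<Rightarrow> bool" where
  "primal N \<longleftrightarrow> proper N \<and> semiring_ideal (UNIV - Prm N)"

(* The empty intersection is M, so M itself is semiprime.  This affects neither the subsemimodule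
   spaces, from which M is excluded, nor the class of extraordinary subsemimodules. *)
definition semiprime :: "'m set \<Rightarrow> bool" where
  "semiprime N \<longleftrightarrow> (\<exists>\<P>. (\<forall>P\<in>\<P>. prime P) \<and> N = \<Inter>\<P>)"

definition extraordinary :: "'m set \<Rightarrow> bool" where
  "extraordinary N \<longleftrightarrow>
    prime N \<and> (\<forall>L K. semiprime L \<and> semiprime K \<and> L \<inter> K \<subseteq> N \<longrightarrow> L \<subseteq> N \<or> K \<subseteq> N)"

definition strongly_irreducible :: "'m set \<Rightarrow> bool" where
  "strongly_irreducible N \<longleftrightarrow> subsemimodule N \<and>
    (\<forall>L K. subsemimodule L \<and> subsemimodule K \<and> L \<inter> K \<subseteq> N \<longrightarrow> L \<subseteq> N \<or> K \<subseteq> N)"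

definition irreducible :: "'m set \<Rightarrow> bool" where
  "irreducible N \<longleftrightarrow> subsemimodule N \<and>
    \<not> (\<exists>L K. subsemimodule L \<and> subsemimodule K \<and> N \<subset> L \<and> N \<subset> K \<and> N = L \<inter> K)"

definition completely_irreducible :: "'m set \<Rightarrow> bool" where
  "completely_irreducible N \<longleftrightarrow> subsemimodule N \<and>
    \<not> (\<exists>\<K>. (\<forall>K\<in>\<K>. subsemimodule K \<and> N \<subset> K) \<and> N = \<Inter>\<K>)"

definition cyclic :: "'m set \<Rightarrow> bool" where
  "cyclic N \<longleftrightarrow> (\<exists>x. N = subsemimodule hull {x})"

definition finitely_generated :: "'m set \<Rightarrow> bool" where
  "finitely_generated N \<longleftrightarrow> (\<exists>X. finite X \<and> N = subsemimodule hull X)"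

definition minimal :: "'m set \<Rightarrow> bool" where
  "minimal N \<longleftrightarrow> subsemimodule N \<and> N \<noteq> {0} \<and>
    (\<forall>K. subsemimodule K \<and> K \<noteq> {0} \<and> K \<subseteq> N \<longrightarrow> K = N)"

primrec distinguished :: "dis_class \<Rightarrow> 'm set \<Rightarrow> bool" where
  "distinguished Subtractive = subtractive"
| "distinguished Strong = strong"
| "distinguished Proper = proper"
| "distinguished Maximal = maximal"
| "distinguished Prime = prime"
| "distinguished Primary = primary"
| "distinguished Weakly_Prime = weakly_prime"
| "distinguished Primal = primal"
| "distinguished Semiprime = semiprime"
| "distinguished Extraordinary = extraordinary"
| "distinguished Strongly_Irreducible = strongly_irreducible"
| "distinguished Irreducible = irreducible"
| "distinguished Completely_Irreducible = completely_irreducible"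
| "distinguished Cyclic = cyclic"
| "distinguished Finitely_Generated = finitely_generated"
| "distinguished Minimal = minimal"
| "distinguished Minimal_Prime = (\<lambda>N. minimal N \<and> prime N)"

definition Dis :: "dis_class \<Rightarrow> 'm set set" where
  "Dis c = {N. subsemimodule N \<and> distinguished c N \<and> N \<noteq> UNIV}"

definition V :: "dis_class \<Rightarrow> 'm set \<Rightarrow> 'm set set" where
  "V c N = {L \<in> Dis c. N \<subseteq> L}"

definition subsemimodule_space :: "dis_class \<Rightarrow> 'm set topology" where
  "subsemimodule_space c = topology_generated_by {Dis c - V c N |N. subsemimodule N}"

definition omega :: "dis_class \<Rightarrow> 'm set \<Rightarrow> 'm set" where
  "omega c N = \<Inter>(V c N)"

lemma topspace_subsemimodule_space: "topspace (subsemimodule_space c) = Dis c"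
proof -
  have "subsemimodule UNIV" "V c UNIV = {}"
    by (auto simp: subsemimodule_def V_def Dis_def)
  then have "Dis c \<in> {Dis c - V c N |N. subsemimodule N}"
    by blast
  then show ?thesis
    unfolding subsemimodule_space_def topology_generated_by_topspace by blast
qed

(* The intersection with Dis c only matters for the empty family. *)
lemma closedin_subsemimodule_space:
  "closedin (subsemimodule_space c) C \<longleftrightarrow>
    (\<exists>\<C>. (\<forall>S\<in>\<C>. (finite union_of (\<lambda>T. \<exists>N. subsemimodule N \<and> T = V c N)) S) \<and>
         C = Dis c \<inter> \<Inter>\<C>)"
proof
  let ?fin = "finite union_of (\<lambda>T. \<exists>N. subsemimodule N \<and> T = V c N)"
  have aux: "\<exists>\<C>. (\<forall>S\<in>\<C>. ?fin S) \<and> Dis c - U = Dis c \<inter> \<Inter>\<C>"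
    if "generate_topology_on {Dis c - V c N |N. subsemimodule N} U" for U
    using that
  proof induction
    case Empty
    show ?case by (rule exI[of _ "{}"]) simp
  next
    case (Int a b)
    then obtain A B where A: "\<forall>S\<in>A. ?fin S" "Dis c - a = Dis c \<inter> \<Inter>A"
      and B: "\<forall>S\<in>B. ?fin S" "Dis c - b = Dis c \<inter> \<Inter>B" by blast
    let ?C = "{S \<union> T |S T. S \<in> A \<and> T \<in> B}"
    have "?fin (S \<union> T)" if "S \<in> A" "T \<in> B" for S T
      using A(1) B(1) that by (simp add: finite_union_of_Un)
    then have "\<forall>S\<in>?C. ?fin S" by blast
    moreover have "Dis c - a \<inter> b = Dis c \<inter> (\<Inter>A \<union> \<Inter>B)" using A B by blast
    moreover have "\<Inter>A \<union> \<Inter>B = \<Inter>?C"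
    proof (rule set_eqI)
      fix x
      have "(\<forall>S\<in>A. x \<in> S) \<or> (\<forall>T\<in>B. x \<in> T) \<longleftrightarrow> (\<forall>S\<in>A. \<forall>T\<in>B. x \<in> S \<union> T)" by auto
      also have "\<dots> \<longleftrightarrow> (\<forall>U\<in>?C. x \<in> U)" by blast
      finally show "x \<in> \<Inter>A \<union> \<Inter>B \<longleftrightarrow> x \<in> \<Inter>?C" by simp
    qed
    ultimately have "(\<forall>S\<in>?C. ?fin S) \<and> Dis c - a \<inter> b = Dis c \<inter> \<Inter>?C" by simp
    then show ?case by (rule exI)
  next
    case (UN K)
    from UN.IH have "\<forall>k\<in>K. \<exists>\<C>. (\<forall>S\<in>\<C>. ?fin S) \<and> Dis c - k = Dis c \<inter> \<Inter>\<C>" by (rule ballI)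
    from bchoice[OF this] obtain f
      where f: "\<forall>k\<in>K. (\<forall>S\<in>f k. ?fin S) \<and> Dis c - k = Dis c \<inter> \<Inter>(f k)" ..
    have "Dis c - \<Union>K = Dis c \<inter> (\<Inter>k\<in>K. Dis c - k)" by blast
    also have "\<dots> = Dis c \<inter> (\<Inter>k\<in>K. Dis c \<inter> \<Inter>(f k))" using f by simp
    also have "\<dots> = Dis c \<inter> \<Inter>(\<Union>(f ` K))" by blast
    finally have "(\<forall>S\<in>\<Union>(f ` K). ?fin S) \<and> Dis c - \<Union>K = Dis c \<inter> \<Inter>(\<Union>(f ` K))"
      using f by simp
    then show ?case by (rule exI)
  next
    case (Basis s)
    then obtain N where "subsemimodule N" "s = Dis c - V c N" by blast
    moreover from this have "?fin (V c N)" by (intro finite_union_of_inc) blast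
    ultimately show ?case by (intro exI[of _ "{V c N}"]) auto
  qed
  {
    assume C: "closedin (subsemimodule_space c) C"
    then have "C \<subseteq> Dis c" "openin (subsemimodule_space c) (Dis c - C)"
      by (auto simp: closedin_def topspace_subsemimodule_space)
    moreover have "generate_topology_on {Dis c - V c N |N. subsemimodule N} (Dis c - C)"
      using calculation(2) unfolding subsemimodule_space_def
      by (rule openin_topology_generated_by)
    from aux[OF this] show "\<exists>\<C>. (\<forall>S\<in>\<C>. ?fin S) \<and> C = Dis c \<inter> \<Inter>\<C>"
      using calculation(1) by (simp add: double_diff)
  }
  assume "\<exists>\<C>. (\<forall>S\<in>\<C>. ?fin S) \<and> C = Dis c \<inter> \<Inter>\<C>"
  then obtain \<C> where \<C>: "\<forall>S\<in>\<C>. ?fin S" and eq: "C = \<Inter>(insert (Dis c) \<C>)" by auto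
  have V: "closedin (subsemimodule_space c) (V c N)" if "subsemimodule N" for N
  proof -
    have "openin (subsemimodule_space c) (Dis c - V c N)"
      unfolding subsemimodule_space_def
      by (rule topology_generated_by_Basis) (use that in blast)
    moreover have "V c N \<subseteq> Dis c" by (auto simp: V_def)
    ultimately show ?thesis by (simp add: closedin_def topspace_subsemimodule_space)
  qed
  have "closedin (subsemimodule_space c) S" if "S \<in> \<C>" for S
  proof -
    from \<C> that have "?fin S" by blast
    then have "\<exists>\<U>. finite \<U> \<and> \<U> \<subseteq> {T. \<exists>N. subsemimodule N \<and> T = V c N} \<and> \<Union>\<U> = S"
      unfolding union_of_def Collect_mem_eq .
    then obtain \<U> where fin: "finite \<U>" and S: "\<Union>\<U> = S"
      and sub: "\<U> \<subseteq> {T. \<exists>N. subsemimodule N \<and> T = V c N}" by (elim exE conjE)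
    have "closedin (subsemimodule_space c) T" if "T \<in> \<U>" for T
      using sub that V by auto
    with fin show ?thesis unfolding S[symmetric] by (rule closedin_Union)
  qed
  moreover have "closedin (subsemimodule_space c) (Dis c)"
    by (metis closedin_topspace topspace_subsemimodule_space)
  ultimately show "closedin (subsemimodule_space c) C"
    unfolding eq by (intro closedin_Inter) auto
qed

end

definition irreducible_closedin :: "'a topology \<Rightarrow> 'a set \<Rightarrow> bool" where
  "irreducible_closedin X S \<longleftrightarrow> closedin X S \<and>
    \<not> (\<exists>S1 S2. closedin X S1 \<and> closedin X S2 \<and> S1 \<subset> S \<and> S2 \<subset> S \<and> S = S1 \<union> S2)"

definition generic_point :: "'a topology \<Rightarrow> 'a set \<Rightarrow> 'a \<Rightarrow> bool" where
  "generic_point X S x \<longleftrightarrow> closedin X S \<and> x \<in> S \<and> X closure_of {x} = S"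

end

theory Submission
  imports Defs
begin

text \<open>
  Inclusion of subsemimodules is the specialization order of the space: every subbasic closed
  set, hence every closed set, is closed upwards, so the closure of a point \<open>L\<close> is
  \<open>V c L\<close>.  A generic point of \<open>V c N\<close> is therefore a least element of
  \<open>V c N\<close> with respect to inclusion.  A least element, if there is one, is unique and equal to
  the intersection \<open>omega c N\<close>, and it exists exactly if this intersection belongs to
  \<open>V c N\<close>.  The two sides of the theorem thus agree for each \<open>N\<close> separately.
\<close>

context semimodule
begin

lemma closedin_V:
  assumes "subsemimodule N"
  shows "closedin (subsemimodule_space c) (V c N)"
proof -
  have "openin (subsemimodule_space c) (Dis c - V c N)"
    unfolding subsemimodule_space_def
    by (rule topology_generated_by_Basis) (use assms in blast)
  moreover have "V c N \<subseteq> Dis c"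
    by (auto simp: V_def)
  ultimately show ?thesis
    by (simp add: closedin_def topspace_subsemimodule_space)
qed

text \<open>
  The property passes from the subbasic open sets to all open sets because it is preserved by
  intersections and unions.
\<close>

lemma openin_subsemimodule_space_downward:
  assumes "openin (subsemimodule_space c) U" "L' \<in> U" "L \<in> Dis c" "L \<subseteq> L'"
  shows "L \<in> U"
proof -
  have "generate_topology_on {Dis c - V c N |N. subsemimodule N} U"
    using assms(1) unfolding subsemimodule_space_def by (rule openin_topology_generated_by)
  then show ?thesis
    using assms(2)
  proof induction
    case (Basis S)
    then obtain N where "S = Dis c - V c N"
      by blast
    then show ?case
      using Basis.prems assms(3,4) unfolding V_def by blast
  qed blast+
qed

lemma closure_of_singleton_eq_V:
  assumes "L \<in> Dis c"
  shows "subsemimodule_space c closure_of {L} = V c L"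
proof
  have "subsemimodule L"
    using assms by (simp add: Dis_def)
  then show "subsemimodule_space c closure_of {L} \<subseteq> V c L"
    using assms by (intro closure_of_minimal closedin_V) (auto simp: V_def)
  show "V c L \<subseteq> subsemimodule_space c closure_of {L}"
    unfolding V_def
  proof safe
    fix L'
    assume "L' \<in> Dis c" "L \<subseteq> L'"
    then show "L' \<in> subsemimodule_space c closure_of {L}"
      using openin_subsemimodule_space_downward[OF _ _ assms \<open>L \<subseteq> L'\<close>]
      by (simp add: in_closure_of topspace_subsemimodule_space)
  qed
qed

lemma generic_point_V_iff:
  assumes "subsemimodule N"
  shows "generic_point (subsemimodule_space c) (V c N) L \<longleftrightarrow> L \<in> V c N \<and> L = omega c N"
proof (cases "L \<in> V c N")
  case True
  then have "L \<in> Dis c" "N \<subseteq> L"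
    by (auto simp: V_def)
  then have "generic_point (subsemimodule_space c) (V c N) L \<longleftrightarrow> V c L = V c N"
    using True assms by (simp add: generic_point_def closure_of_singleton_eq_V closedin_V)
  (* Since N is contained in L, equality only requires L to be a lower bound of V c N. *)
  also have "\<dots> \<longleftrightarrow> (\<forall>K\<in>V c N. L \<subseteq> K)"
  proof -
    have "V c L \<subseteq> V c N"
      using \<open>N \<subseteq> L\<close> unfolding V_def by blast
    moreover have "K \<in> V c L \<longleftrightarrow> L \<subseteq> K" if "K \<in> V c N" for K
      using that by (simp add: V_def)
    ultimately show ?thesis
      by blast
  qed
  also have "\<dots> \<longleftrightarrow> L = omega c N"
    using True unfolding omega_def by blast
  finally show ?thesis
    using True by simp
next
  case False
  then show ?thesis
    by (simp add: generic_point_def)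
qed

lemma ex1_generic_point_V_iff:
  assumes "subsemimodule N"
  shows "(\<exists>!L. generic_point (subsemimodule_space c) (V c N) L) \<longleftrightarrow> omega c N \<in> V c N"
  unfolding generic_point_V_iff[OF assms] by blast

end

theorem theorem3p10:
  fixes scale :: "'r::{comm_semiring_0,comm_monoid_mult} \<Rightarrow> 'm::comm_monoid_add \<Rightarrow> 'm"
    and c :: dis_class
  assumes "semimodule scale"
  shows "(\<forall>N. semimodule.subsemimodule scale N \<and> semimodule.V scale c N \<noteq> {} \<and>
            irreducible_closedin (semimodule.subsemimodule_space scale c) (semimodule.V scale c N)
          \<longrightarrow> (\<exists>!x. generic_point (semimodule.subsemimodule_space scale c)
                      (semimodule.V scale c N) x))
    \<longleftrightarrow>
         (\<forall>N. semimodule.subsemimodule scale N \<and> semimodule.V scale c N \<noteq> {} \<and>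
            irreducible_closedin (semimodule.subsemimodule_space scale c) (semimodule.V scale c N)
          \<longrightarrow> semimodule.omega scale c N \<in> semimodule.V scale c N)"
  by (intro iff_allI imp_cong refl semimodule.ex1_generic_point_V_iff[OF assms]) simp

end
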